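(* Let $q$ be an odd prime power, let $n\ge1$ and $0\le k\le n$, and let $\psi\in\{+,-\}$ (identified with $\pm1$ when used as a factor). If $n$ is odd, define $t=0$ if $(-1)^{(n+1)/2}$ is a square in $\mathbf{F}_q$ and $t=1$ otherwise. Then $$\mathrm{sz}^{\psi}(n+1,k+1)=\frac1q\,\mathrm{sz}^{\psi}(n+1,k)+\frac{(-1)^t\cdot\psi}{2}\,\mathrm{sz}(n,k)\bigl(q^{(n+1)/2}-q^{(n-1)/2}\bigr).$$ If $n$ is even, define $t=0$ if $(-1)^{n/2}$ is a square in $\mathbf{F}_q$ and $t=1$ otherwise. Then $$\mathrm{sz}^{\psi}(n+1,k+1)=\frac1q\,\mathrm{sz}^{\psi}(n+1,k)-\frac{(-1)^t}{2}\bigl(\mathrm{sz}^{+}(n,k)-\mathrm{sz}^{-}(n,k)\bigr)\bigl(q^{n/2}-q^{(n-2)/2}\bigr).$$ These recursions have initial values $$\mathrm{sz}^{+}(2m+1,0)=\frac12\,\mathrm{sz}(2m+1,0)\qquad\text{and}\qquad \mathrm{sz}^{+}(2m,0)=\frac12\cdot\frac{q^m+(\psi(-1))^m}{q^m}\,\mathrm{sz}(2m,0),$$ where $\psi(-1)=+1$ if $-1$ is a square in $\mathbf{F}_q$ and $-1$ otherwise.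
   Context: $\mathbf{F}_q$ is the field with $q$ elements. $\mathrm{sz}(n,k)$ is the number of invertible $n\times n$ symmetric matrices over $\mathbf{F}_q$ whose first $k$ diagonal entries equal $0$, with no other restrictions. $\mathrm{sz}^{\psi}(n,k)$ counts only those that have character $\psi$, where an invertible symmetric matrix has character $+$ if its determinant is a square in $\mathbf{F}_q$ and $-$ otherwise. *)

theory Defs
  imports
    "Jordan_Normal_Form.Determinant"
    "HOL-Computational_Algebra.Nth_Powers"
begin

(* The field F_q is a type 'a of sort {field, finite} with CARD('a) = q. *)

(* Matrix indices start at 0, so the first k diagonal entries are those at (i, i) with i < k;
   only k \<le> n is meaningful. *)
definition sz_mats :: "nat \<Rightarrow> nat \<Rightarrow> 'a :: {field, finite} mat set" where
  "sz_mats n k =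
     {A \<in> carrier_mat n n. invertible_mat A \<and> transpose_mat A = A \<and> (\<forall>i<k. A $$ (i, i) = 0)}"

(* The signs + and - are represented by the integers 1 and -1. *)
definition square_sign :: "'a :: {field, finite} \<Rightarrow> int" where
  "square_sign x = (if is_square x then 1 else -1)"

definition mat_character :: "'a :: {field, finite} mat \<Rightarrow> int" where
  "mat_character A = square_sign (det A)"

(* The itself argument names the field, which is not determined by n and k. *)
definition sz :: "'a :: {field, finite} itself \<Rightarrow> nat \<Rightarrow> nat \<Rightarrow> nat" where
  "sz F n k = card (sz_mats n k :: 'a mat set)"

definition sz_char :: "'a :: {field, finite} itself \<Rightarrow> int \<Rightarrow> nat \<Rightarrow> nat \<Rightarrow> nat" where
  "sz_char F \<psi> n k = card {A \<in> sz_mats n k :: 'a mat set. mat_character A = \<psi>}"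

end

theory Submission
  imports Defs
begin

text \<open>
  Write \<open>q\<close> for the order of the field. A symmetric matrix \<open>A\<close> of size \<open>n + 1\<close> is an \<open>n \<times> n\<close>
  symmetric matrix \<open>B\<close> bordered by a vector \<open>v\<close> and a corner entry \<open>a\<close>. The recursion compares
  the matrices with \<open>a = 0\<close> with those whose corner is free, one pair \<open>(B, v)\<close> at a time.

  If \<open>B\<close> is singular, \<open>det A\<close> does not depend on \<open>a\<close>, so among the borderings with a given
  character exactly one \<open>q\<close>-th has \<open>a = 0\<close>. If \<open>B\<close> is invertible, write \<open>v = B w\<close>; then \<open>det A =
  det B * (a - w \<bullet> B w)\<close>. With \<open>a\<close> free this takes every value equally often. With \<open>a = 0\<close> the
  number of \<open>w\<close> that give the right character depends on how often the quadratic form \<open>w \<bullet> B w\<close>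
  takes each value, and this number is a classical one: for a nondegenerate form of rank \<open>n\<close> it
  is \<open>q ^ (n - 1)\<close> plus a deviation that depends on \<open>B\<close> only through \<open>n\<close> and \<open>det B\<close>
  (\<open>sum_quad\<close>, proved by splitting off one square at a time). Since the deviation sees only \<open>det
  B\<close>, summing over all \<open>B\<close> with \<open>k\<close> prescribed zeros yields a multiple of \<open>sz(n, k)\<close> for odd \<open>n\<close>
  and of \<open>sz\<^sup>+(n, k) - sz\<^sup>-(n, k)\<close> for even \<open>n\<close> (\<open>class_count_recursion\<close>, \<open>sum_correction_odd\<close>,
  \<open>sum_correction_even\<close>).

  The initial values need a second relation between the matrices with \<open>a = 0\<close> and all matrices.
  It comes from those with \<open>a \<noteq> 0\<close>: there \<open>det A\<close> is \<open>a\<close> times the determinant of the Schur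
  complement of \<open>a\<close>, which runs over all symmetric matrices as \<open>B\<close> does, so both characters
  occur \<open>q ^ n * (q - 1) / 2 * sz(n, 0)\<close> times (\<open>class_count_nonzero_last\<close>). Eliminating the
  matrices with \<open>a = 0\<close> gives \<open>sz\<^sup>\<psi>(n + 1, 0)\<close> in terms of size \<open>n\<close> (\<open>class_count_all\<close>), whose
  right-hand side is independent of \<open>\<psi>\<close> for even \<open>n\<close> and a multiple of \<open>sz(n, 0)\<close> for odd \<open>n\<close>.
\<close>

section \<open>The quadratic character of a finite field of odd order\<close>

text \<open>Unlike \<open>square_sign\<close>, which is \<open>1\<close> at zero, this is the usual quadratic character: it vanishes
  at zero, hence is multiplicative and has sum zero.\<close>

definition qchar :: "'a :: {field, finite} \<Rightarrow> real" where
  "qchar x = (if x = 0 then 0 else real_of_int (square_sign x))"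

lemma qchar_0 [simp]: "qchar 0 = 0"
  by (simp add: qchar_def)

lemma qchar_square: "x \<noteq> 0 \<Longrightarrow> qchar (x * x) = 1"
  unfolding qchar_def square_sign_def is_nth_power_def by (auto simp: power2_eq_square)

lemma qchar_1 [simp]: "qchar 1 = 1"
  using qchar_square[of 1] by simp

lemma qchar_cases:
  fixes x :: "'a :: {field, finite}"
  obtains "x = 0" "qchar x = 0"
  | y where "x = y * y" "y \<noteq> 0" "qchar x = 1"
  | "x \<noteq> 0" "\<nexists>y. x = y * y" "qchar x = -1"
proof (cases "\<exists>y. x = y * y")
  case True
  then obtain y where "x = y * y" ..
  with that(1,2) qchar_square[of y] show ?thesis
    by (cases "y = 0") auto
next
  case False
  then have "\<not> is_square x"
    by (simp add: is_nth_power_def power2_eq_square)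
  with False that(1,3) show ?thesis
    by (cases "x = 0") (auto simp: qchar_def square_sign_def)
qed

text \<open>In characteristic two, \<open>x \<mapsto> x + 1\<close> is an involution without fixed points, so its orbits \<open>{x, x
  + 1}\<close> cut the field into pairs.\<close>

lemma two_neq_0:
  assumes "odd (card (UNIV :: 'a :: {field, finite} set))"
  shows "(2 :: 'a) \<noteq> 0"
proof
  assume two: "(2 :: 'a) = 0"
  define C where "C = range (\<lambda>x :: 'a. {x, x + 1})"
  have dbl: "x + 1 + 1 = x" for x :: 'a
    using two by (simp add: add.assoc)
  have "2 * card C = card (\<Union> C)"
  proof (rule card_partition)
    show "A \<inter> B = {}" if AB: "A \<in> C" "B \<in> C" "A \<noteq> B" for A B
    proof -
      obtain x y where xy: "A = {x, x + 1}" "B = {y, y + 1}"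
        using AB by (auto simp: C_def)
      have "A = B" if "z \<in> A" "z \<in> B" for z
        using that dbl[of x] dbl[of y] unfolding xy by auto
      with AB(3) show ?thesis by auto
    qed
  qed (auto simp: C_def)
  also have "\<Union> C = UNIV"
    by (auto simp: C_def)
  finally show False
    using assms by (metis even_mult_iff even_numeral)
qed

lemma card_square_roots:
  fixes c :: "'a :: {field, finite}"
  assumes "(2 :: 'a) \<noteq> 0"
  shows "real (card {x. x * x = c}) = 1 + qchar c"
proof (cases c rule: qchar_cases)
  case 1
  then have "{x. x * x = c} = {0}" by auto
  with 1 show ?thesis by simp
next
  case (2 y)
  have "y \<noteq> - y"
    using 2(2) assms by (simp add: eq_neg_iff_add_eq_0 flip: mult_2)
  moreover have "{x. x * x = c} = {y, - y}"
    using 2 by (auto simp: square_eq_iff)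
  ultimately show ?thesis
    using 2 by simp
next
  case 3
  then have "{x. x * x = c} = {}" by auto
  with 3 show ?thesis by (simp only:) simp
qed

lemma sum_over_squares:
  fixes g :: "'a :: {field, finite} \<Rightarrow> real"
  assumes "(2 :: 'a) \<noteq> 0"
  shows "(\<Sum>x\<in>UNIV. g (x * x)) = (\<Sum>y\<in>UNIV. g y * (1 + qchar y))"
proof -
  have "(\<Sum>x\<in>UNIV. g (x * x)) = (\<Sum>y\<in>UNIV. \<Sum>x\<in>{x \<in> UNIV. x * x = y}. g (x * x))"
    by (rule sum.group[symmetric]) auto
  also have "\<dots> = (\<Sum>y\<in>UNIV. g y * real (card {x. x * x = y}))"
    by (intro sum.cong refl) (simp add: mult.commute)
  finally show ?thesis
    using card_square_roots[OF assms] by simp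
qed

lemma sum_affine:
  fixes g :: "'a :: {field, finite} \<Rightarrow> real"
  assumes "a \<noteq> 0"
  shows "(\<Sum>x\<in>UNIV. g (a * x + b)) = (\<Sum>x\<in>UNIV. g x)"
  using assms by (intro sum.reindex_bij_witness[of _ "\<lambda>x. (x - b) / a" "\<lambda>x. a * x + b"]) auto

lemma sum_mult_shift:
  fixes g :: "'a :: {field, finite} \<Rightarrow> real"
  assumes "a \<noteq> 0"
  shows "(\<Sum>x\<in>UNIV. g (a * x)) = (\<Sum>x\<in>UNIV. g x)"
  using sum_affine[OF assms, of g 0] by simp

text \<open>Squaring maps \<open>q\<close> elements to the field with fibres of size \<open>1 + qchar y\<close>; count both sides.\<close>

lemma sum_qchar:
  assumes "(2 :: 'a :: {field, finite}) \<noteq> 0"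
  shows "(\<Sum>x\<in>UNIV. qchar (x :: 'a)) = 0"
  using sum_over_squares[OF assms, of "\<lambda>_. 1"] by (simp add: sum.distrib)

text \<open>Only a nonsquare \<open>a\<close> needs work. There \<open>qchar (a * y) + qchar y\<close> is zero if \<open>y\<close> is a square,
  and at most zero otherwise, as \<open>qchar y = -1\<close>. Its sum over the field is zero, so it vanishes
  everywhere.\<close>

lemma qchar_mult:
  fixes a x :: "'a :: {field, finite}"
  assumes "(2 :: 'a) \<noteq> 0"
  shows "qchar (a * x) = qchar a * qchar x"
proof -
  have square: "qchar (s * s * y) = qchar y" if "s \<noteq> 0" for s y :: 'a
  proof (cases y rule: qchar_cases)
    case (2 z)
    then show ?thesis
      using that qchar_square[of "s * z"] by (simp add: ac_simps)
  next
    case 3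
    have "\<nexists>z. s * s * y = z * z"
    proof
      assume "\<exists>z. s * s * y = z * z"
      then obtain z where "s * s * y = z * z" ..
      then have "y = (z / s) * (z / s)"
        using that by (simp add: field_simps)
      with 3 show False by blast
    qed
    then show ?thesis
      using 3 that by (cases "s * s * y" rule: qchar_cases) auto
  qed simp
  show ?thesis
  proof (cases a rule: qchar_cases)
    case 3
    have neg: "qchar (a * y) = - qchar y" if "qchar y \<noteq> -1" for y
      using that
    proof (cases y rule: qchar_cases)
      case (2 s)
      then show ?thesis
        using 3 square[of s a] by (simp add: mult.commute)
    qed auto
    have "(\<Sum>y\<in>UNIV. - (qchar (a * y) + qchar y)) = 0"
      using sum_mult_shift[OF 3(1), of qchar] sum_qchar[OF assms]
      by (simp only: sum_negf sum.distrib)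
    moreover have "- (qchar (a * y) + qchar y) \<ge> 0" for y
    proof (cases "qchar y = -1")
      case True
      then show ?thesis
        by (cases "a * y" rule: qchar_cases) auto
    qed (simp add: neg)
    ultimately have "\<forall>y\<in>UNIV. - (qchar (a * y) + qchar y) = 0"
      by (subst (asm) sum_nonneg_eq_0_iff) auto
    then have "- (qchar (a * x) + qchar x) = 0"
      by blast
    with 3 show ?thesis by simp
  qed (auto simp: square)
qed

text \<open>The deviation of the one-point mass \<open>q\<close> at zero from its mean value \<open>1\<close>. In even rank it plays
  the part that \<open>qchar\<close> plays in odd rank: adding a square to the form turns one into the other,
  as the next two sums show.\<close>

definition balance :: "'a :: {field, finite} \<Rightarrow> real" where
  "balance c = (if c = 0 then real (card (UNIV :: 'a set)) else 0) - 1"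

lemma qchar_divide:
  fixes a b :: "'a :: {field, finite}"
  assumes "(2 :: 'a) \<noteq> 0"
  shows "qchar (b / a) = qchar (a * b)"
proof (cases "a = 0")
  case False
  then have "a * b = (a * a) * (b / a)" by simp
  with False show ?thesis
    by (metis mult_1 qchar_mult[OF assms] qchar_square)
qed simp

lemma sum_balance_minus_squares:
  fixes a c :: "'a :: {field, finite}"
  assumes "(2 :: 'a) \<noteq> 0" and "a \<noteq> 0"
  shows "(\<Sum>x\<in>UNIV. balance (c - a * (x * x))) = real (card (UNIV :: 'a set)) * qchar (a * c)"
proof -
  have "(\<Sum>x\<in>UNIV. balance (c - a * (x * x)))
      = (\<Sum>x\<in>UNIV. if x * x = c / a then real (card (UNIV :: 'a set)) else 0)
        - real (card (UNIV :: 'a set))"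
  proof -
    have "c - a * (x * x) = 0 \<longleftrightarrow> x * x = c / a" for x
      using assms(2) by (auto simp: field_simps)
    then show ?thesis
      by (simp add: balance_def sum_subtractf)
  qed
  also have "\<dots> = real (card (UNIV :: 'a set)) * qchar (c / a)"
    by (simp add: sum.If_cases card_square_roots[OF assms(1)] algebra_simps)
  finally show ?thesis
    by (simp add: qchar_divide assms)
qed

text \<open>For \<open>c \<noteq> 0\<close>, replacing \<open>x * x\<close> by \<open>y\<close> with weight \<open>1 + qchar y\<close> leaves the sum of \<open>qchar ((c -
  a * y) * y)\<close>. Dividing the argument by the square \<open>y * y\<close> turns it into \<open>c / y - a\<close>, which
  takes every value except \<open>- a\<close>.\<close>

lemma sum_qchar_minus_squares:
  fixes a c :: "'a :: {field, finite}"
  assumes "(2 :: 'a) \<noteq> 0" and "a \<noteq> 0"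
  shows "(\<Sum>x\<in>UNIV. qchar (c - a * (x * x))) = qchar (- a) * balance c"
proof (cases "c = 0")
  case True
  have "(\<Sum>x\<in>UNIV. qchar (c - a * (x * x))) = (\<Sum>x\<in>UNIV. if x = (0 :: 'a) then 0 else qchar (- a))"
  proof (intro sum.cong refl)
    fix x :: 'a
    have "qchar (- a * (x * x)) = qchar (- a) * qchar (x * x)"
      by (rule qchar_mult[OF assms(1)])
    then show "qchar (c - a * (x * x)) = (if x = 0 then 0 else qchar (- a))"
      using True by (simp add: qchar_square)
  qed
  also have "\<dots> = (\<Sum>x\<in>UNIV. qchar (- a) - (if x = (0 :: 'a) then qchar (- a) else 0))"
    by (intro sum.cong) auto
  also have "\<dots> = qchar (- a) * balance c"
    using True by (simp add: sum_subtractf balance_def algebra_simps)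
  finally show ?thesis .
next
  case False
  have "(\<Sum>x\<in>UNIV. qchar (c - a * (x * x))) = (\<Sum>y\<in>UNIV. qchar (c - a * y) * (1 + qchar y))"
    by (rule sum_over_squares[OF assms(1)])
  also have "\<dots> = (\<Sum>y\<in>UNIV. qchar (- a * y + c)) + (\<Sum>y\<in>UNIV. qchar (c - a * y) * qchar y)"
    by (simp add: algebra_simps sum.distrib)
  also have "(\<Sum>y\<in>UNIV. qchar (- a * y + c)) = 0"
    using sum_affine[of "- a" qchar c] sum_qchar[OF assms(1)] assms(2) by simp
  also have "(\<Sum>y\<in>UNIV. qchar (c - a * y) * qchar y) = (\<Sum>y\<in>UNIV - {0}. qchar (c / y - a))"
  proof -
    have "(\<Sum>y\<in>UNIV. qchar (c - a * y) * qchar y) = (\<Sum>y\<in>UNIV - {0}. qchar (c - a * y) * qchar y)"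
      by (subst sum.remove[of _ 0]) auto
    also have "\<dots> = (\<Sum>y\<in>UNIV - {0}. qchar (c / y - a))"
    proof (intro sum.cong refl)
      fix y :: 'a
      assume "y \<in> UNIV - {0}"
      then have "c / y - a = (c - a * y) / y"
        by (simp add: field_simps)
      then show "qchar (c - a * y) * qchar y = qchar (c / y - a)"
        by (simp add: qchar_divide[OF assms(1)] qchar_mult[OF assms(1)])
    qed
    finally show ?thesis .
  qed
  also have "\<dots> = (\<Sum>z\<in>UNIV - {- a}. qchar z)"
    using False
    by (intro sum.reindex_bij_witness[of _ "\<lambda>z. c / (z + a)" "\<lambda>y. c / y - a"])
       (auto simp: eq_neg_iff_add_eq_0)
  also have "\<dots> = - qchar (- a)"
    using sum_qchar[OF assms(1)] by (simp add: sum_diff1)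
  finally show ?thesis
    using False by (simp add: balance_def)
qed

section \<open>Bordered matrices\<close>

definition border :: "'a mat \<Rightarrow> 'a vec \<Rightarrow> 'a \<Rightarrow> 'a :: zero mat" where
  "border B v a = four_block_mat B (mat (dim_vec v) 1 (\<lambda>(i, j). v $ i))
     (mat 1 (dim_vec v) (\<lambda>(i, j). v $ j)) (mat 1 1 (\<lambda>_. a))"

lemma border_carrier [simp]:
  "B \<in> carrier_mat n n \<Longrightarrow> v \<in> carrier_vec n \<Longrightarrow> border B v a \<in> carrier_mat (Suc n) (Suc n)"
  using four_block_carrier_mat[of B n n "mat 1 1 (\<lambda>_. a)" 1 1] by (simp add: border_def)

lemma index_border:
  assumes "B \<in> carrier_mat n n" "v \<in> carrier_vec n" "i < Suc n" "j < Suc n"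
  shows "border B v a $$ (i, j) =
    (if i < n then if j < n then B $$ (i, j) else v $ i else if j < n then v $ j else a)"
  using assms by (auto simp: border_def)

definition snoc_vec :: "'a vec \<Rightarrow> 'a \<Rightarrow> 'a vec" where
  "snoc_vec w x = w @\<^sub>v vec 1 (\<lambda>_. x)"

lemma snoc_vec_carrier [simp]: "w \<in> carrier_vec n \<Longrightarrow> snoc_vec w x \<in> carrier_vec (Suc n)"
  using append_carrier_vec[of w n "vec 1 (\<lambda>_. x)" 1] by (simp add: snoc_vec_def)

text \<open>Induction on the dimension of a vector space splits off the last coordinate, the one that
  belongs to the corner of a bordered matrix.\<close>

lemma bij_betw_snoc_vec:
  "bij_betw (\<lambda>(w, x). snoc_vec w x) (carrier_vec n \<times> UNIV) (carrier_vec (Suc n))"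
proof (rule bij_betw_byWitness[where f' = "\<lambda>u. (vec n (\<lambda>i. u $ i), u $ n)"])
  show "\<forall>p\<in>carrier_vec n \<times> UNIV. (\<lambda>u. (vec n (\<lambda>i. u $ i), u $ n)) (case p of (w, x) \<Rightarrow> snoc_vec w x) = p"
    by (auto simp: snoc_vec_def)
  show "\<forall>u\<in>carrier_vec (Suc n). (case (vec n (\<lambda>i. u $ i), u $ n) of (w, x) \<Rightarrow> snoc_vec w x) = u"
    by (auto simp: snoc_vec_def intro!: eq_vecI dest: less_antisym)
qed auto

lemma sum_carrier_vec_Suc:
  fixes f :: "'a vec \<Rightarrow> real"
  shows "(\<Sum>u\<in>carrier_vec (Suc n). f u) = (\<Sum>w\<in>carrier_vec n. \<Sum>x\<in>UNIV. f (snoc_vec w x))"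
  by (subst sum.reindex_bij_betw[OF bij_betw_snoc_vec, symmetric])
     (simp add: sum.cartesian_product prod.case_distrib case_prod_unfold)

lemma card_carrier_vec: "card (carrier_vec n :: 'a :: finite vec set) = card (UNIV :: 'a set) ^ n"
proof (induction n)
  case 0
  have "carrier_vec 0 = {vec 0 undefined :: 'a vec}"
    by (auto intro: eq_vecI)
  then show ?case by simp
next
  case (Suc n)
  have "bij_betw (\<lambda>(w, x). snoc_vec w (x :: 'a)) (carrier_vec n \<times> UNIV) (carrier_vec (Suc n))"
    by (rule bij_betw_snoc_vec)
  then show ?case
    using Suc bij_betw_same_card by (fastforce simp: card_cartesian_product mult.commute)
qed

definition quad :: "'a :: comm_ring_1 mat \<Rightarrow> 'a vec \<Rightarrow> 'a" where
  "quad B w = w \<bullet> (B *\<^sub>v w)"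

lemma quad_border:
  assumes B: "B \<in> carrier_mat n n" and v: "v \<in> carrier_vec n" and w: "w \<in> carrier_vec n"
  shows "quad (border B v a) (snoc_vec w x) = quad B w + 2 * x * (v \<bullet> w) + a * x * x"
proof -
  let ?x = "vec 1 (\<lambda>_. x)" and ?c = "mat n 1 (\<lambda>(i, j). v $ i)"
    and ?r = "mat 1 n (\<lambda>(i, j). v $ j)" and ?a = "mat 1 1 (\<lambda>_. a)"
  have c: "?c *\<^sub>v ?x = x \<cdot>\<^sub>v v"
    using v by (intro eq_vecI) (auto simp: scalar_prod_def)
  have r: "?r *\<^sub>v w = vec 1 (\<lambda>_. v \<bullet> w)"
    using v w by (intro eq_vecI) (auto simp: scalar_prod_def)
  have a: "?a *\<^sub>v ?x = vec 1 (\<lambda>_. a * x)"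
    by (intro eq_vecI) (auto simp: scalar_prod_def)
  have "dim_vec v = n" using v by simp
  then have "border B v a *\<^sub>v snoc_vec w x = (B *\<^sub>v w + ?c *\<^sub>v ?x) @\<^sub>v (?r *\<^sub>v w + ?a *\<^sub>v ?x)"
    unfolding border_def snoc_vec_def
    by (simp only:) (intro four_block_mat_mult_vec[of _ n n _ 1 _ 1], use B w in auto)
  then have mult: "border B v a *\<^sub>v snoc_vec w x
      = (B *\<^sub>v w + x \<cdot>\<^sub>v v) @\<^sub>v (vec 1 (\<lambda>_. v \<bullet> w) + vec 1 (\<lambda>_. a * x))"
    by (simp only: c r a)
  have "quad (border B v a) (snoc_vec w x)
      = w \<bullet> (B *\<^sub>v w + x \<cdot>\<^sub>v v) + ?x \<bullet> (vec 1 (\<lambda>_. v \<bullet> w) + vec 1 (\<lambda>_. a * x))"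
    unfolding quad_def mult unfolding snoc_vec_def
    by (intro scalar_prod_append[of _ n _ 1]) (use B v w in auto)
  also have "w \<bullet> (B *\<^sub>v w + x \<cdot>\<^sub>v v) = quad B w + x * (v \<bullet> w)"
    using B v w by (simp add: quad_def scalar_prod_add_distrib[of _ n] comm_scalar_prod[of w n v])
  also have "?x \<bullet> (vec 1 (\<lambda>_. v \<bullet> w) + vec 1 (\<lambda>_. a * x)) = x * (v \<bullet> w + a * x)"
    by (simp add: scalar_prod_def)
  finally show ?thesis
    by (simp add: algebra_simps)
qed

text \<open>The Schur complement of the corner \<open>a\<close> in \<open>border B v a\<close>.\<close>

definition schur :: "'a mat \<Rightarrow> 'a vec \<Rightarrow> 'a \<Rightarrow> 'a :: field mat" where
  "schur B v a = mat (dim_row B) (dim_col B) (\<lambda>(i, j). B $$ (i, j) - v $ i * v $ j / a)"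

lemma schur_carrier [simp]: "B \<in> carrier_mat n n \<Longrightarrow> schur B v a \<in> carrier_mat n n"
  by (simp add: schur_def)

lemma transpose_schur:
  assumes "B \<in> carrier_mat n n" "transpose_mat B = B"
  shows "transpose_mat (schur B v a) = schur B v a"
proof (rule eq_matI)
  fix i j assume "i < dim_row (schur B v a)" "j < dim_col (schur B v a)"
  then have ij: "i < n" "j < n" using assms by (auto simp: schur_def)
  then have "B $$ (j, i) = B $$ (i, j)"
    using assms index_transpose_mat(1)[of i B j] by auto
  then show "transpose_mat (schur B v a) $$ (i, j) = schur B v a $$ (i, j)"
    using ij assms by (auto simp: schur_def mult.commute)
qed (use assms in \<open>auto simp: schur_def\<close>)

lemma quad_schur:
  fixes B :: "'a :: field mat"
  assumes B: "B \<in> carrier_mat n n" and v: "v \<in> carrier_vec n" and w: "w \<in> carrier_vec n"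
  shows "quad (schur B v a) w = quad B w - (v \<bullet> w) * (v \<bullet> w) / a"
proof -
  have "schur B v a *\<^sub>v w = B *\<^sub>v w - ((v \<bullet> w) / a) \<cdot>\<^sub>v v"
  proof (rule eq_vecI)
    fix i assume "i < dim_vec (B *\<^sub>v w - ((v \<bullet> w) / a) \<cdot>\<^sub>v v)"
    then show "(schur B v a *\<^sub>v w) $ i = (B *\<^sub>v w - ((v \<bullet> w) / a) \<cdot>\<^sub>v v) $ i"
      using assms
      by (auto simp: schur_def scalar_prod_def sum_subtractf sum_distrib_left sum_divide_distrib algebra_simps)
  qed (use assms in \<open>auto simp: schur_def\<close>)
  then show ?thesis
    using assms by (simp add: quad_def scalar_prod_minus_distrib[of _ n] comm_scalar_prod[of w n v])
qed

text \<open>Completing the square in the last variable.\<close>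

lemma quad_border_square:
  fixes B :: "'a :: field mat"
  assumes "B \<in> carrier_mat n n" "v \<in> carrier_vec n" "w \<in> carrier_vec n" "a \<noteq> 0"
  shows "quad (border B v a) (snoc_vec w x)
    = quad (schur B v a) w + a * ((x + (v \<bullet> w) / a) * (x + (v \<bullet> w) / a))"
  using assms by (simp add: quad_border quad_schur field_simps)

text \<open>Clearing the last row with the corner \<open>a\<close> factors the matrix into a block upper triangular and
  a unipotent lower triangular matrix.\<close>

lemma det_border_schur:
  fixes B :: "'a :: field mat"
  assumes B: "B \<in> carrier_mat n n" and v: "v \<in> carrier_vec n" and a: "a \<noteq> 0"
  shows "det (border B v a) = a * det (schur B v a)"
proof -
  let ?L = "four_block_mat (schur B v a) (mat n 1 (\<lambda>(i, j). v $ i)) (0\<^sub>m 1 n) (mat 1 1 (\<lambda>_. a))"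
  let ?R = "four_block_mat (1\<^sub>m n) (0\<^sub>m n 1) (mat 1 n (\<lambda>(i, j). v $ j / a)) (1\<^sub>m 1)"
  have "border B v a = ?L * ?R"
  proof -
    have "schur B v a + mat n 1 (\<lambda>(i, j). v $ i) * mat 1 n (\<lambda>(i, j). v $ j / a) = B"
      using B v by (intro eq_matI) (auto simp: schur_def scalar_prod_def)
    moreover have "mat 1 1 (\<lambda>_. a) * mat 1 n (\<lambda>(i, j). v $ j / a) = mat 1 n (\<lambda>(i, j). v $ j)"
      using a by (intro eq_matI) (auto simp: scalar_prod_def)
    ultimately show ?thesis
      using B v right_mult_one_mat[OF schur_carrier[OF B]] right_mult_zero_mat[OF schur_carrier[OF B]]
      by (subst mult_four_block_mat[of _ n n _ 1 _ 1 _ _ n _ 1]) (auto simp: border_def)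
  qed
  moreover have "det ?L = det (schur B v a) * a"
    by (subst det_four_block_mat_lower_left_zero[of _ n _ 1]) (use B in \<open>auto simp: det_single\<close>)
  moreover have "det ?R = 1"
    by (subst det_four_block_mat_upper_right_zero[of _ n _ 1]) auto
  moreover have "?L \<in> carrier_mat (n + 1) (n + 1)" "?R \<in> carrier_mat (n + 1) (n + 1)"
    by (rule four_block_carrier_mat; simp add: B)+
  ultimately show ?thesis
    by (simp add: det_mult[of _ "n + 1"])
qed

text \<open>Here \<open>B\<close> itself clears the last column, whose upper part \<open>B w\<close> is a combination of the columns
  of \<open>B\<close>. No division by \<open>B\<close> occurs, and the corner turns into \<open>a - w \<bullet> B w\<close>.\<close>

lemma det_border_mult_vec:
  fixes B :: "'a :: field mat"
  assumes B: "B \<in> carrier_mat n n" "transpose_mat B = B" and w: "w \<in> carrier_vec n"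
  shows "det (border B (B *\<^sub>v w) a) = det B * (a - quad B w)"
proof -
  let ?r = "mat 1 n (\<lambda>(i, j). (B *\<^sub>v w) $ j)"
  let ?L = "four_block_mat B (0\<^sub>m n 1) ?r (mat 1 1 (\<lambda>_. a - quad B w))"
  let ?R = "four_block_mat (1\<^sub>m n) (mat n 1 (\<lambda>(i, j). w $ i)) (0\<^sub>m 1 n) (1\<^sub>m 1)"
  have r: "?r \<in> carrier_mat 1 n" by simp
  have "B * mat n 1 (\<lambda>(i, j). w $ i) = mat n 1 (\<lambda>(i, j). (B *\<^sub>v w) $ i)"
    using B w by (intro eq_matI) (auto simp: scalar_prod_def)
  moreover have "?r * mat n 1 (\<lambda>(i, j). w $ i) + mat 1 1 (\<lambda>_. a - quad B w) = mat 1 1 (\<lambda>_. a)"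
    using B w by (intro eq_matI) (auto simp: quad_def scalar_prod_def mult.commute)
  ultimately have "border B (B *\<^sub>v w) a = ?L * ?R"
    using B w r right_mult_one_mat[OF r]
    by (subst mult_four_block_mat[of _ n n _ 1 _ 1 _ _ n _ 1]) (auto simp: border_def)
  moreover have "det ?L = det B * (a - quad B w)"
    by (subst det_four_block_mat_upper_right_zero[of _ n _ 1]) (use B in \<open>auto simp: det_single\<close>)
  moreover have "det ?R = 1"
    by (subst det_four_block_mat_lower_left_zero[of _ n _ 1]) auto
  moreover have "?L \<in> carrier_mat (n + 1) (n + 1)" "?R \<in> carrier_mat (n + 1) (n + 1)"
    by (rule four_block_carrier_mat; simp add: B)+
  ultimately show ?thesis
    by (simp add: det_mult[of _ "n + 1"])
qed

text \<open>In the expansion along the last row, the corner is multiplied by \<open>det B\<close>.\<close>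

lemma det_border_singular:
  fixes B :: "'a :: field mat"
  assumes B: "B \<in> carrier_mat n n" and v: "v \<in> carrier_vec n" and d: "det B = 0"
  shows "det (border B v a) = det (border B v b)"
proof -
  have dim: "dim_row (border B v c) = Suc n" "dim_col (border B v c) = Suc n" for c
    using border_carrier[OF B v, of c] by auto
  have exp: "det (border B v c) = (\<Sum>j<n. v $ j * cofactor (border B v 0) n j)" for c
  proof -
    have del: "mat_delete (border B v c) n j = mat_delete (border B v 0) n j" for j
      using B v by (intro eq_matI) (auto simp: mat_delete_def index_border dim)
    have "mat_delete (border B v 0) n n = B"
      using B v by (intro eq_matI) (auto simp: mat_delete_def index_border dim)
    then have "cofactor (border B v c) n n = 0"
      using d by (simp add: cofactor_def del)
    then show ?thesis
      using B v laplace_expansion_row[OF border_carrier[OF B v, of c], of n]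
      by (simp add: index_border cofactor_def del)
  qed
  show ?thesis
    by (simp only: exp)
qed

section \<open>Value distribution of nondegenerate quadratic forms\<close>

lemma ex_two_sided_inverse:
  fixes P :: "'a :: field mat"
  assumes P: "P \<in> carrier_mat n n" and "det P \<noteq> 0"
  obtains Q where "Q \<in> carrier_mat n n" "P * Q = 1\<^sub>m n" "Q * P = 1\<^sub>m n"
  using det_non_zero_imp_unit[OF assms, of "()"]
  by (auto simp: Units_def ring_mat_def)

lemma bij_betw_mult_mat_vec:
  fixes P :: "'a :: field mat"
  assumes P: "P \<in> carrier_mat n n" and d: "det P \<noteq> 0"
  shows "bij_betw (\<lambda>w. P *\<^sub>v w) (carrier_vec n) (carrier_vec n)"
proof -
  obtain Q where Q: "Q \<in> carrier_mat n n" "P * Q = 1\<^sub>m n" "Q * P = 1\<^sub>m n"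
    using ex_two_sided_inverse[OF P d] .
  show ?thesis
    by (rule bij_betw_byWitness[where f' = "\<lambda>w. Q *\<^sub>v w"])
       (use P Q in \<open>auto simp: assoc_mult_mat_vec[symmetric] simp del: assoc_mult_mat_vec\<close>)
qed

lemma quad_congruence:
  fixes A :: "'a :: comm_ring_1 mat"
  assumes A: "A \<in> carrier_mat n n" and P: "P \<in> carrier_mat n n" and w: "w \<in> carrier_vec n"
  shows "quad (transpose_mat P * A * P) w = quad A (P *\<^sub>v w)"
proof -
  have "(transpose_mat P * A * P) *\<^sub>v w = transpose_mat P *\<^sub>v (A *\<^sub>v (P *\<^sub>v w))"
    using assms by (simp add: assoc_mult_mat_vec[of _ n n _ n])
  then have "quad (transpose_mat P * A * P) w = (transpose_mat P *\<^sub>v (A *\<^sub>v (P *\<^sub>v w))) \<bullet> w"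
    using assms by (simp add: quad_def comm_scalar_prod[of w n])
  also have "\<dots> = (A *\<^sub>v (P *\<^sub>v w)) \<bullet> (P *\<^sub>v w)"
    by (rule transpose_vec_mult_scalar[of _ n n]) (use assms in auto)
  also have "\<dots> = quad A (P *\<^sub>v w)"
    using assms by (simp add: quad_def comm_scalar_prod[of "P *\<^sub>v w" n])
  finally show ?thesis .
qed

text \<open>To complete the square in the last variable, the form must not vanish at the last basis vector
  \<open>e\<^sub>n\<close>. If it vanishes there, some \<open>A $$ (n, j)\<close> is nonzero because \<open>A\<close> is invertible, and
  adding \<open>t\<close> times \<open>e\<^sub>j\<close> to \<open>e\<^sub>n\<close> changes the value to \<open>t\<^sup>2 * A $$ (j, j) + 2 * t * A $$ (n,
  j)\<close>.\<close>

lemma symmetric_last_entry_congruence: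
  fixes A :: "'a :: field mat"
  assumes two: "(2 :: 'a) \<noteq> 0"
    and A: "A \<in> carrier_mat (Suc n) (Suc n)" and sym: "transpose_mat A = A" and d: "det A \<noteq> 0"
  obtains P where "P \<in> carrier_mat (Suc n) (Suc n)" "det P = 1"
    "(transpose_mat P * A * P) $$ (n, n) \<noteq> 0"
proof (cases "A $$ (n, n) = 0")
  case False
  then show ?thesis
    using that[of "1\<^sub>m (Suc n)"] A by simp
next
  case True
  have "\<exists>j<Suc n. A $$ (n, j) \<noteq> 0"
  proof (rule ccontr)
    assume "\<not> ?thesis"
    with d laplace_expansion_row[OF A, of n] show False by simp
  qed
  then obtain j where j: "j < n" "A $$ (n, j) \<noteq> 0"
    using True less_antisym by blast
  have symj: "A $$ (j, n) = A $$ (n, j)"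
    using A j index_transpose_mat(1)[of j A n] by (simp add: sym)
  have "\<exists>t. t * A $$ (j, j) * t + 2 * t * A $$ (n, j) \<noteq> 0"
  proof (rule ccontr)
    assume "\<not> ?thesis"
    \<comment> \<open>The values at \<open>t = 1\<close> and \<open>t = -1\<close> differ by \<open>4 * A $$ (n, j)\<close>, so one of them is nonzero.\<close>
    then have "A $$ (j, j) + 2 * A $$ (n, j) = 0" "A $$ (j, j) - 2 * A $$ (n, j) = 0"
      by (force dest: spec[of _ 1], force dest: spec[of _ "-1"])
    then have "2 * (2 * A $$ (n, j)) = 0"
      by (simp add: algebra_simps)
    with two j(2) show False
      by (simp only: mult_eq_0_iff) simp
  qed
  then obtain t where t: "t * A $$ (j, j) * t + 2 * t * A $$ (n, j) \<noteq> 0" by blast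
  define P where "P = addrow_mat (Suc n) t j n"
  have P: "P \<in> carrier_mat (Suc n) (Suc n)" by (simp add: P_def)
  have AP: "A * P = addcol t n j A"
    unfolding P_def by (rule addcol_mat[symmetric]) (use A j in auto)
  have "transpose_mat P * A * P = transpose_mat P * (A * P)"
    using A P by (simp add: assoc_mult_mat[of _ "Suc n" "Suc n" _ "Suc n" _ "Suc n"])
  also have "\<dots> = transpose_mat (transpose_mat (A * P) * P)"
    using A P by (simp add: transpose_mult[of _ "Suc n" "Suc n" _ "Suc n"])
  also have "transpose_mat (A * P) * P = addcol t n j (transpose_mat (A * P))"
    unfolding P_def by (rule addcol_mat[symmetric, of _ "Suc n"]) (use A j in auto)
  finally have "transpose_mat P * A * P = transpose_mat (addcol t n j (transpose_mat (addcol t n j A)))"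
    by (simp add: AP)
  then have "(transpose_mat P * A * P) $$ (n, n) = t * A $$ (j, j) * t + 2 * t * A $$ (n, j)"
    using A j True symj by (simp add: algebra_simps)
  moreover have "det P = 1"
    using j by (simp add: P_def det_addrow_mat)
  ultimately show ?thesis
    using that[OF P] t by simp
qed

lemma symmetric_eq_border:
  assumes A: "A \<in> carrier_mat (Suc n) (Suc n)" and sym: "transpose_mat A = A"
  shows "border (mat n n (\<lambda>(i, j). A $$ (i, j))) (vec n (\<lambda>i. A $$ (i, n))) (A $$ (n, n)) = A"
    and "transpose_mat (mat n n (\<lambda>(i, j). A $$ (i, j))) = mat n n (\<lambda>(i, j). A $$ (i, j))"
proof -
  have *: "A $$ (j, i) = A $$ (i, j)" if "i < Suc n" "j < Suc n" for i j
    using A that index_transpose_mat(1)[of i A j] by (simp add: sym)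
  show "transpose_mat (mat n n (\<lambda>(i, j). A $$ (i, j))) = mat n n (\<lambda>(i, j). A $$ (i, j))"
    by (intro eq_matI) (auto simp: *)
  let ?M = "border (mat n n (\<lambda>(i, j). A $$ (i, j))) (vec n (\<lambda>i. A $$ (i, n))) (A $$ (n, n))"
  have M: "?M \<in> carrier_mat (Suc n) (Suc n)" by simp
  show "?M = A"
  proof (rule eq_matI)
    fix i j assume "i < dim_row A" "j < dim_col A"
    then have ij: "i < Suc n" "j < Suc n" using A by auto
    show "?M $$ (i, j) = A $$ (i, j)"
      by (subst index_border[of _ n]) (use ij *[of n j] in \<open>auto simp: less_Suc_eq\<close>)
  qed (use A carrier_matD[OF M] in simp_all)
qed

text \<open>In odd characteristic, a nondegenerate quadratic form of rank \<open>n\<close> and determinant \<open>d\<close> takes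
  the value \<open>c\<close> exactly \<open>(q ^ n + value_deviation n d c) / q\<close> times. The factor \<open>q\<close> keeps the
  exponents nonnegative for \<open>n = 0\<close>.\<close>

definition value_deviation :: "nat \<Rightarrow> 'a :: {field, finite} \<Rightarrow> 'a \<Rightarrow> real" where
  "value_deviation n d c = (let q = real (card (UNIV :: 'a set)); m = n div 2 in
     if even n then q ^ m * qchar ((-1) ^ m * d) * balance c
     else q ^ (m + 1) * qchar ((-1) ^ m * d * c))"

text \<open>The recursion of the deviation when the square \<open>a * x\<^sup>2\<close> is added to the form.\<close>

lemma sum_value_deviation_minus_squares:
  fixes a c d :: "'a :: {field, finite}"
  assumes two: "(2 :: 'a) \<noteq> 0" and a: "a \<noteq> 0"
  shows "(\<Sum>x\<in>UNIV. value_deviation n d (c - a * (x * x))) = value_deviation (Suc n) (a * d) c"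
proof (cases "even n")
  case True
  then have "(\<Sum>x\<in>UNIV. value_deviation n d (c - a * (x * x)))
      = real (card (UNIV :: 'a set)) ^ (n div 2) * qchar ((-1) ^ (n div 2) * d)
        * (\<Sum>x\<in>UNIV. balance (c - a * (x * x)))"
    by (simp add: value_deviation_def sum_distrib_left Let_def)
  also have "\<dots> = value_deviation (Suc n) (a * d) c"
  proof -
    have "Suc n div 2 = n div 2" using True by presburger
    then show ?thesis
      using True unfolding value_deviation_def Let_def sum_balance_minus_squares[OF assms]
      by (simp only: qchar_mult[OF two]) simp
  qed
  finally show ?thesis .
next
  case False
  then have "(\<Sum>x\<in>UNIV. value_deviation n d (c - a * (x * x)))
      = real (card (UNIV :: 'a set)) ^ (n div 2 + 1) * qchar ((-1) ^ (n div 2) * d)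
        * (\<Sum>x\<in>UNIV. qchar (c - a * (x * x)))"
    by (simp add: value_deviation_def sum_distrib_left Let_def qchar_mult[OF two] mult.assoc)
  also have "\<dots> = value_deviation (Suc n) (a * d) c"
  proof -
    have "Suc n div 2 = n div 2 + 1" using False by presburger
    moreover have "(- 1) ^ (n div 2 + 1) * (a * d) = ((- 1) ^ (n div 2) * d) * (- a)"
      by simp
    ultimately show ?thesis
      using False unfolding value_deviation_def Let_def sum_qchar_minus_squares[OF assms]
      by (simp only: qchar_mult[OF two]) simp
  qed
  finally show ?thesis .
qed

text \<open>The value distribution is stated in dual form, against an arbitrary function \<open>g\<close> of the value.
  Adding a square to the form then is a shift in the argument of \<open>g\<close>, and the induction
  hypothesis applies to the shifted function.\<close>

lemma sum_quad:
  fixes A :: "'a :: {field, finite} mat" and g :: "'a \<Rightarrow> real"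
  assumes two: "(2 :: 'a) \<noteq> 0"
    and "A \<in> carrier_mat n n" "transpose_mat A = A" "det A \<noteq> 0"
  shows "real (card (UNIV :: 'a set)) * (\<Sum>w\<in>carrier_vec n. g (quad A w))
    = (\<Sum>c\<in>UNIV. g c * (real (card (UNIV :: 'a set)) ^ n + value_deviation n (det A) c))"
  using assms(2-)
proof (induction n arbitrary: A g)
  case 0
  have "carrier_vec 0 = {vec 0 undefined :: 'a vec}"
    by (auto intro: eq_vecI)
  moreover have "quad A (vec 0 undefined) = 0"
    using 0 by (simp add: quad_def scalar_prod_def)
  moreover have "(\<Sum>c\<in>UNIV. g c * (1 + balance c)) = (\<Sum>c\<in>UNIV. if c = (0 :: 'a) then g 0 * real (card (UNIV :: 'a set)) else 0)"
    by (intro sum.cong) (auto simp: balance_def)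
  ultimately show ?case
    using 0 by (simp add: value_deviation_def)
next
  case (Suc n)
  let ?q = "real (card (UNIV :: 'a set))"
  obtain P where P: "P \<in> carrier_mat (Suc n) (Suc n)" "det P = 1"
    "(transpose_mat P * A * P) $$ (n, n) \<noteq> 0"
    using symmetric_last_entry_congruence[OF two Suc.prems] .
  define M where "M = transpose_mat P * A * P"
  have M: "M \<in> carrier_mat (Suc n) (Suc n)"
    using P Suc.prems by (simp add: M_def)
  have Msym: "transpose_mat M = M"
    using P Suc.prems unfolding M_def
    by (simp add: transpose_mult[of _ "Suc n" "Suc n" _ "Suc n"] assoc_mult_mat[of _ "Suc n" "Suc n" _ "Suc n" _ "Suc n"])
  have detM: "det M = det A"
    using P Suc.prems by (simp add: M_def det_mult[of _ "Suc n"] det_transpose[of _ "Suc n"])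
  define B where "B = mat n n (\<lambda>(i, j). M $$ (i, j))"
  define v where "v = vec n (\<lambda>i. M $$ (i, n))"
  define a where "a = M $$ (n, n)"
  have B: "B \<in> carrier_mat n n" and v: "v \<in> carrier_vec n" and a: "a \<noteq> 0"
    using P by (simp_all add: B_def v_def a_def M_def)
  have MB: "M = border B v a" and Bsym: "transpose_mat B = B"
    using symmetric_eq_border[OF M Msym] by (simp_all add: B_def v_def a_def)
  define S where "S = schur B v a"
  have S: "S \<in> carrier_mat n n" "transpose_mat S = S"
    using B Bsym transpose_schur[OF B Bsym] by (simp_all add: S_def)
  have detS: "det A = a * det S"
    using det_border_schur[OF B v a] detM by (simp add: MB S_def)
  have IH: "?q * (\<Sum>w\<in>carrier_vec n. h (quad S w))
      = (\<Sum>c\<in>UNIV. h c * (?q ^ n + value_deviation n (det S) c))" for h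
    using Suc.IH[OF S] detS Suc.prems by simp
  have "(\<Sum>u\<in>carrier_vec (Suc n). g (quad A u)) = (\<Sum>u\<in>carrier_vec (Suc n). g (quad A (P *\<^sub>v u)))"
    by (rule sum.reindex_bij_betw[OF bij_betw_mult_mat_vec[OF P(1)], symmetric]) (simp add: P(2))
  also have "\<dots> = (\<Sum>u\<in>carrier_vec (Suc n). g (quad M u))"
    by (intro sum.cong refl) (simp only: M_def quad_congruence[OF Suc.prems(1) P(1)])
  also have "\<dots> = (\<Sum>w\<in>carrier_vec n. \<Sum>x\<in>UNIV. g (quad M (snoc_vec w x)))"
    by (rule sum_carrier_vec_Suc)
  also have "\<dots> = (\<Sum>w\<in>carrier_vec n. \<Sum>x\<in>UNIV. g (quad S w + a * (x * x)))"
  proof (rule sum.cong)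
    fix w :: "'a vec" assume w: "w \<in> carrier_vec n"
    show "(\<Sum>x\<in>UNIV. g (quad M (snoc_vec w x))) = (\<Sum>x\<in>UNIV. g (quad S w + a * (x * x)))"
      using sum_affine[of 1 "\<lambda>x. g (quad S w + a * (x * x))" "(v \<bullet> w) / a"]
      by (simp add: MB S_def quad_border_square[OF B v w a])
  qed simp
  also have "\<dots> = (\<Sum>x\<in>UNIV. \<Sum>w\<in>carrier_vec n. g (quad S w + a * (x * x)))"
    by (rule sum.swap)
  finally have "?q * (\<Sum>u\<in>carrier_vec (Suc n). g (quad A u))
      = (\<Sum>x\<in>UNIV. \<Sum>c\<in>UNIV. g (c + a * (x * x)) * (?q ^ n + value_deviation n (det S) c))"
    by (simp add: sum_distrib_left IH[of "\<lambda>c. g (c + a * (_ * _))", symmetric])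
  also have "\<dots> = (\<Sum>x\<in>UNIV. \<Sum>c\<in>UNIV. g c * (?q ^ n + value_deviation n (det S) (c - a * (x * x))))"
  proof (rule sum.cong)
    fix x :: 'a
    show "(\<Sum>c\<in>UNIV. g (c + a * (x * x)) * (?q ^ n + value_deviation n (det S) c))
        = (\<Sum>c\<in>UNIV. g c * (?q ^ n + value_deviation n (det S) (c - a * (x * x))))"
      using sum_affine[of 1 "\<lambda>c. g c * (?q ^ n + value_deviation n (det S) (c - a * (x * x)))" "a * (x * x)"]
      by simp
  qed simp
  also have "\<dots> = (\<Sum>c\<in>UNIV. g c * (\<Sum>x\<in>UNIV. ?q ^ n + value_deviation n (det S) (c - a * (x * x))))"
    by (subst sum.swap) (simp add: sum_distrib_left)
  finally show ?case
    by (simp add: sum.distrib sum_value_deviation_minus_squares[OF two a] detS)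
qed

section \<open>The correction term of a bordered matrix\<close>

definition class_indicator :: "int \<Rightarrow> 'a :: {field, finite} \<Rightarrow> real" where
  "class_indicator \<psi> x = (if x \<noteq> 0 \<and> square_sign x = \<psi> then 1 else 0)"

lemma class_indicator_0 [simp]: "class_indicator \<psi> 0 = 0"
  by (simp add: class_indicator_def)

lemma class_indicator_qchar:
  assumes "\<psi> \<in> {1, -1}"
  shows "class_indicator \<psi> x = (qchar x * qchar x + real_of_int \<psi> * qchar x) / 2"
  using assms by (auto simp: class_indicator_def qchar_def square_sign_def)

lemma class_indicator_add: "class_indicator 1 x + class_indicator (-1) x = (if x = 0 then 0 else 1)"
  by (simp add: class_indicator_def square_sign_def)

lemma class_indicator_diff: "class_indicator 1 x - class_indicator (-1) x = qchar x"
  by (simp add: class_indicator_def square_sign_def qchar_def)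

lemma qchar_sqr: "qchar x * qchar x = (if x = 0 then 0 else 1)"
  by (simp add: qchar_def square_sign_def)

lemma sum_class_indicator:
  fixes d :: "'a :: {field, finite}"
  assumes two: "(2 :: 'a) \<noteq> 0" and \<psi>: "\<psi> \<in> {1, -1}" and d: "d \<noteq> 0"
  shows "(\<Sum>c\<in>UNIV. class_indicator \<psi> (d * c)) = (real (card (UNIV :: 'a set)) - 1) / 2"
proof -
  have "(\<Sum>c\<in>UNIV. class_indicator \<psi> (d * c)) = (\<Sum>c\<in>UNIV. class_indicator \<psi> (c :: 'a))"
    using d by (rule sum_mult_shift)
  also have "\<dots> = ((\<Sum>c\<in>UNIV. qchar (c :: 'a) * qchar c) + real_of_int \<psi> * (\<Sum>c\<in>UNIV. qchar (c :: 'a))) / 2"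
    using \<psi> by (simp only: class_indicator_qchar sum.distrib sum_distrib_left flip: sum_divide_distrib)
  also have "(\<Sum>c\<in>UNIV. qchar (c :: 'a) * qchar c) = (\<Sum>c\<in>UNIV. 1 - (if c = (0 :: 'a) then 1 else 0))"
    by (intro sum.cong) (auto simp: qchar_sqr)
  finally show ?thesis
    by (simp add: sum_qchar[OF two] sum_subtractf)
qed

text \<open>For invertible \<open>B\<close> with determinant \<open>d\<close> and size \<open>n\<close>, a bordering with corner zero has
  determinant \<open>- d * c\<close>, where \<open>c\<close> is a value of the quadratic form of \<open>B\<close>. The sum below is \<open>q\<close>
  times the effect of the uneven distribution of these values on the number of such borderings
  with character \<open>\<psi>\<close>.\<close>

definition correction :: "int \<Rightarrow> nat \<Rightarrow> 'a :: {field, finite} \<Rightarrow> real" where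
  "correction \<psi> n d = (\<Sum>c\<in>UNIV. class_indicator \<psi> (- d * c) * value_deviation n d c)"

text \<open>In odd rank the deviation is a multiple of \<open>qchar\<close> of the determinant \<open>- d * c\<close> of the
  bordered matrix, which is \<open>\<psi>\<close> wherever the indicator is nonzero; so \<open>d\<close> drops out and \<open>\<psi>\<close>
  remains.\<close>

lemma correction_odd:
  fixes d :: "'a :: {field, finite}"
  assumes two: "(2 :: 'a) \<noteq> 0" and \<psi>: "\<psi> \<in> {1, -1}" and d: "d \<noteq> 0" and n: "n = 2 * m + 1"
  shows "correction \<psi> n d = (real (card (UNIV :: 'a set)) - 1) / 2 * real (card (UNIV :: 'a set)) ^ (m + 1)
    * real_of_int \<psi> * qchar ((-1) ^ (m + 1) :: 'a)"
proof -
  let ?q = "real (card (UNIV :: 'a set))" and ?e = "qchar ((-1) ^ (m + 1) :: 'a)"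
  have summand: "class_indicator \<psi> (- d * c) * value_deviation n d c
      = ?q ^ (m + 1) * ?e * real_of_int \<psi> * class_indicator \<psi> (- d * c)" for c
  proof -
    have "(-1) ^ m * d * c = (-1) ^ (m + 1) * (- d * c)" by simp
    then have "qchar ((-1) ^ m * d * c) = ?e * qchar (- d * c)"
      by (simp only: qchar_mult[OF two])
    then have "value_deviation n d c = ?q ^ (m + 1) * (?e * qchar (- d * c))"
      using n by (simp add: value_deviation_def Let_def)
    then have "class_indicator \<psi> (- d * c) * value_deviation n d c
        = ?q ^ (m + 1) * ?e * (class_indicator \<psi> (- d * c) * qchar (- d * c))"
      by (simp only: mult.assoc mult.left_commute)
    also have "class_indicator \<psi> (- d * c) * qchar (- d * c) = real_of_int \<psi> * class_indicator \<psi> (- d * c)"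
      by (simp add: class_indicator_def qchar_def)
    finally show ?thesis
      by (simp only: mult.assoc)
  qed
  show ?thesis
    unfolding correction_def summand sum_distrib_left[symmetric]
    using sum_class_indicator[OF two \<psi>, of "- d"] d by simp
qed

text \<open>In even rank the deviation is constant on nonzero \<open>c\<close>, and the indicator vanishes at \<open>c = 0\<close>;
  so \<open>\<psi>\<close> drops out and \<open>qchar d\<close> remains.\<close>

lemma correction_even:
  fixes d :: "'a :: {field, finite}"
  assumes two: "(2 :: 'a) \<noteq> 0" and \<psi>: "\<psi> \<in> {1, -1}" and d: "d \<noteq> 0" and n: "n = 2 * m"
  shows "correction \<psi> n d = - ((real (card (UNIV :: 'a set)) - 1) / 2 * real (card (UNIV :: 'a set)) ^ m
    * qchar ((-1) ^ m :: 'a) * qchar d)"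
proof -
  let ?q = "real (card (UNIV :: 'a set))" and ?e = "qchar ((-1) ^ m :: 'a)"
  have summand: "class_indicator \<psi> (- d * c) * value_deviation n d c
      = - (?q ^ m * ?e * qchar d) * class_indicator \<psi> (- d * c)" for c
    using n by (cases "c = 0") (simp_all add: value_deviation_def balance_def qchar_mult[OF two])
  show ?thesis
    unfolding correction_def summand sum_distrib_left[symmetric]
    using sum_class_indicator[OF two \<psi>, of "- d"] d by simp
qed

section \<open>Counting symmetric matrices by bordering\<close>

text \<open>The zero diagonal positions form an arbitrary set, so that the new zero can be placed in the
  corner of a bordered matrix.\<close>

definition sym_mats :: "nat \<Rightarrow> nat set \<Rightarrow> 'a :: zero mat set" where
  "sym_mats n K = {A \<in> carrier_mat n n. transpose_mat A = A \<and> (\<forall>i\<in>K. A $$ (i, i) = 0)}"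

lemma finite_sym_mats: "finite (sym_mats n K :: 'a :: {zero, finite} mat set)"
proof (rule finite_subset)
  show "sym_mats n K \<subseteq> (\<lambda>f :: nat \<times> nat \<Rightarrow> 'a. mat n n f) ` ({..<n} \<times> {..<n} \<rightarrow>\<^sub>E UNIV)"
  proof
    fix A :: "'a mat" assume "A \<in> sym_mats n K"
    then have "A = mat n n (restrict (\<lambda>p. A $$ p) ({..<n} \<times> {..<n}))"
      by (intro eq_matI) (auto simp: sym_mats_def)
    then show "A \<in> (\<lambda>f. mat n n f) ` ({..<n} \<times> {..<n} \<rightarrow>\<^sub>E UNIV)"
      by (intro image_eqI[where x = "restrict (\<lambda>p. A $$ p) ({..<n} \<times> {..<n})"]) simp_all
  qed
qed (intro finite_imageI finite_PiE; simp)

text \<open>The count of the invertible symmetric matrices with character \<open>\<psi>\<close>, as a sum over all symmetric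
  matrices; \<open>class_indicator\<close> discards the singular ones.\<close>

definition class_count :: "int \<Rightarrow> nat \<Rightarrow> nat set \<Rightarrow> 'a :: {field, finite} itself \<Rightarrow> real" where
  "class_count \<psi> n K F = (\<Sum>A\<in>sym_mats n K. class_indicator \<psi> (det (A :: 'a mat)))"

lemma invertible_mat_iff_det:
  fixes A :: "'a :: field mat"
  assumes A: "A \<in> carrier_mat n n"
  shows "invertible_mat A \<longleftrightarrow> det A \<noteq> 0"
proof
  assume "invertible_mat A"
  then obtain B where B: "A * B = 1\<^sub>m n" "B * A = 1\<^sub>m (dim_row B)"
    using A by (auto simp: invertible_mat_def inverts_mat_def)
  have "B \<in> carrier_mat n n"
    using A arg_cong[OF B(1), of dim_col] arg_cong[OF B(2), of dim_col] by auto
  then have "det A * det B = 1"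
    using arg_cong[OF B(1), of det] A by (simp add: det_mult[of _ n])
  then show "det A \<noteq> 0" by auto
next
  assume "det A \<noteq> 0"
  then obtain B where "B \<in> carrier_mat n n" "A * B = 1\<^sub>m n" "B * A = 1\<^sub>m n"
    using ex_two_sided_inverse[OF A] by blast
  then show "invertible_mat A"
    using A by (auto simp: invertible_mat_def inverts_mat_def)
qed

lemma sz_mats_eq: "sz_mats n k = {A \<in> sym_mats n {..<k}. det A \<noteq> 0}"
  by (auto simp: sz_mats_def sym_mats_def invertible_mat_iff_det)

lemma sz_char_eq: "real (sz_char F \<psi> n k) = class_count \<psi> n {..<k} F"
proof -
  have "{A \<in> sz_mats n k :: 'a mat set. mat_character A = \<psi>}
      = {A \<in> sym_mats n {..<k}. det A \<noteq> 0 \<and> square_sign (det A) = \<psi>}"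
    by (auto simp: sz_mats_eq mat_character_def)
  then show ?thesis
    by (simp add: sz_char_def class_count_def class_indicator_def sum.If_cases finite_sym_mats
        Collect_conj_eq Int_assoc)
qed

lemma sz_eq: "real (sz F n k) = class_count 1 n {..<k} F + class_count (-1) n {..<k} F"
proof -
  have "class_count 1 n {..<k} F + class_count (-1) n {..<k} F
      = (\<Sum>A\<in>sym_mats n {..<k}. if det (A :: 'a mat) = 0 then 0 else 1)"
    by (simp add: class_count_def class_indicator_add flip: sum.distrib)
  also have "\<dots> = (\<Sum>A\<in>(sz_mats n k :: 'a mat set). 1 :: real)"
    unfolding sz_mats_eq by (rule sum.mono_neutral_cong_right) (auto simp: finite_sym_mats)
  finally show ?thesis
    by (simp add: sz_def)
qed

lemma border_in_sym_mats:
  assumes B: "B \<in> sym_mats n K" and v: "v \<in> carrier_vec n" and K: "K \<subseteq> {..<n}"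
  shows "border B v a \<in> sym_mats (Suc n) K" "border B v a $$ (n, n) = a"
proof -
  have Bc: "B \<in> carrier_mat n n" and Bs: "transpose_mat B = B"
    using B by (auto simp: sym_mats_def)
  have Bij: "B $$ (j, i) = B $$ (i, j)" if "i < n" "j < n" for i j
    using Bc that index_transpose_mat(1)[of i B j] by (simp add: Bs)
  note c = border_carrier[OF Bc v, of a]
  have "transpose_mat (border B v a) = border B v a"
  proof (rule eq_matI)
    fix i j assume "i < dim_row (border B v a)" "j < dim_col (border B v a)"
    then have "i < Suc n" "j < Suc n" using c by auto
    then show "transpose_mat (border B v a) $$ (i, j) = border B v a $$ (i, j)"
      using c by (simp add: index_border[OF Bc v] Bij)
  qed (use c in auto)
  moreover have "border B v a $$ (i, i) = 0" if "i \<in> K" for i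
    using that B K by (auto simp: index_border[OF Bc v] sym_mats_def)
  ultimately show "border B v a \<in> sym_mats (Suc n) K"
    using c by (simp add: sym_mats_def)
  show "border B v a $$ (n, n) = a"
    by (simp add: index_border[OF Bc v])
qed

text \<open>The set \<open>D\<close> of admissible corners is \<open>UNIV\<close>, \<open>{0}\<close> or \<open>- {0}\<close> in the applications.\<close>

lemma sum_sym_mats_border:
  fixes f :: "'a :: {field, finite} mat \<Rightarrow> real"
  assumes K: "K \<subseteq> {..<n}"
  shows "(\<Sum>A\<in>{A \<in> sym_mats (Suc n) K. A $$ (n, n) \<in> D}. f A)
    = (\<Sum>B\<in>sym_mats n K. \<Sum>v\<in>carrier_vec n. \<Sum>a\<in>D. f (border B v a))"
proof -
  let ?S = "(sym_mats n K :: 'a mat set) \<times> ((carrier_vec n :: 'a vec set) \<times> D)"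
  have "(\<Sum>A\<in>{A \<in> sym_mats (Suc n) K. A $$ (n, n) \<in> D}. f A)
      = (\<Sum>(B, v, a)\<in>?S. f (border B v a))"
  proof (rule sum.reindex_bij_witness[of _ "\<lambda>(B, v, a). border B v a"
      "\<lambda>A. (mat n n (\<lambda>(i, j). A $$ (i, j)), vec n (\<lambda>i. A $$ (i, n)), A $$ (n, n))"])
    fix A :: "'a mat" assume "A \<in> {A \<in> sym_mats (Suc n) K. A $$ (n, n) \<in> D}"
    then have A: "A \<in> carrier_mat (Suc n) (Suc n)" "transpose_mat A = A"
      "\<And>i. i \<in> K \<Longrightarrow> A $$ (i, i) = 0" "A $$ (n, n) \<in> D"
      by (auto simp: sym_mats_def)
    note split = symmetric_eq_border[OF A(1,2)]
    show "(case (mat n n (\<lambda>(i, j). A $$ (i, j)), vec n (\<lambda>i. A $$ (i, n)), A $$ (n, n)) of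
        (B, v, a) \<Rightarrow> border B v a) = A"
      using split(1) by simp
    then show "(case (mat n n (\<lambda>(i, j). A $$ (i, j)), vec n (\<lambda>i. A $$ (i, n)), A $$ (n, n)) of
        (B, v, a) \<Rightarrow> f (border B v a)) = f A"
      by simp
    show "(mat n n (\<lambda>(i, j). A $$ (i, j)), vec n (\<lambda>i. A $$ (i, n)), A $$ (n, n)) \<in> ?S"
      using split(2) A K by (auto simp: sym_mats_def)
  next
    fix p assume "p \<in> ?S"
    then obtain B v a where p: "p = (B, v, a)" "B \<in> sym_mats n K" "v \<in> carrier_vec n" "a \<in> D"
      by auto
    then have B: "B \<in> carrier_mat n n" by (simp add: sym_mats_def)
    note ib = index_border[OF B p(3)]
    show "(case p of (B, v, a) \<Rightarrow> border B v a) \<in> {A \<in> sym_mats (Suc n) K. A $$ (n, n) \<in> D}"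
      using p border_in_sym_mats[OF p(2,3) K] by simp
    have "mat n n (\<lambda>(i, j). border B v a $$ (i, j)) = B"
      using B by (intro eq_matI) (auto simp: ib)
    moreover have "vec n (\<lambda>i. border B v a $$ (i, n)) = v"
      using p(3) by (intro eq_vecI) (auto simp: ib)
    moreover have "border B v a $$ (n, n) = a"
      by (simp add: ib)
    ultimately show "(\<lambda>A. (mat n n (\<lambda>(i, j). A $$ (i, j)), vec n (\<lambda>i. A $$ (i, n)), A $$ (n, n)))
        (case p of (B, v, a) \<Rightarrow> border B v a) = p"
      using p(1) by simp
  qed
  then show ?thesis
    by (simp add: sum.cartesian_product)
qed

text \<open>The comparison of the corner zero with a free corner. It holds for every \<open>B\<close> separately: for
  singular \<open>B\<close> the determinant ignores the corner, and for invertible \<open>B\<close> the vectors are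
  parametrized as \<open>v = B w\<close> and \<open>sum_quad\<close> gives the distribution of \<open>w \<bullet> B w\<close>. Its constant
  part \<open>q ^ n\<close> accounts for the average over all corners, and the deviation is left.\<close>

lemma class_count_insert_last:
  assumes two: "(2 :: 'a :: {field, finite}) \<noteq> 0" and \<psi>: "\<psi> \<in> {1, -1}" and K: "K \<subseteq> {..<n}"
  shows "real (card (UNIV :: 'a set)) * class_count \<psi> (Suc n) (insert n K) TYPE('a)
    = class_count \<psi> (Suc n) K TYPE('a)
      + (\<Sum>B\<in>sym_mats n K. if det (B :: 'a mat) = 0 then 0 else correction \<psi> n (det B))"
proof -
  let ?q = "real (card (UNIV :: 'a set))" and ?G = "class_indicator \<psi> :: 'a \<Rightarrow> real"
  have per_block: "?q * (\<Sum>v\<in>carrier_vec n. ?G (det (border B v 0)))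
      = (\<Sum>v\<in>carrier_vec n. \<Sum>a\<in>UNIV. ?G (det (border B v a)))
        + (if det B = 0 then 0 else correction \<psi> n (det B))"
    if "B \<in> sym_mats n K" for B :: "'a mat"
  proof -
    have B: "B \<in> carrier_mat n n" "transpose_mat B = B"
      using that by (auto simp: sym_mats_def)
    show ?thesis
    proof (cases "det B = 0")
      case True
      have "(\<Sum>v\<in>carrier_vec n. \<Sum>a\<in>UNIV. ?G (det (border B v a)))
          = (\<Sum>v\<in>carrier_vec n. \<Sum>a\<in>(UNIV :: 'a set). ?G (det (border B v 0)))"
      proof (rule sum.cong)
        fix v :: "'a vec" assume v: "v \<in> carrier_vec n"
        show "(\<Sum>a\<in>UNIV. ?G (det (border B v a))) = (\<Sum>a\<in>(UNIV :: 'a set). ?G (det (border B v 0)))"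
          by (rule sum.cong) (use det_border_singular[OF B(1) v True] in metis)+
      qed simp
      then show ?thesis
        using True by (simp add: sum_distrib_left)
    next
      case False
      have reindex: "(\<Sum>v\<in>carrier_vec n. h v) = (\<Sum>w\<in>carrier_vec n. h (B *\<^sub>v w))" for h :: "'a vec \<Rightarrow> real"
        by (rule sum.reindex_bij_betw[OF bij_betw_mult_mat_vec[OF B(1) False], symmetric])
      have "(\<Sum>v\<in>carrier_vec n. \<Sum>a\<in>UNIV. ?G (det (border B v a)))
          = (\<Sum>w\<in>carrier_vec n. \<Sum>a\<in>UNIV. ?G (det B * (a - quad B w)))"
        by (subst reindex, intro sum.cong refl) (simp add: det_border_mult_vec[OF B])
      also have "\<dots> = (\<Sum>w\<in>(carrier_vec n :: 'a vec set). (?q - 1) / 2)"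
      proof (rule sum.cong)
        fix w :: "'a vec"
        have "(\<Sum>a\<in>UNIV. ?G (det B * (a - quad B w))) = (\<Sum>a\<in>UNIV. ?G (det B * a))"
          using sum_affine[of 1 "\<lambda>a. ?G (det B * a)" "- quad B w"] by simp
        then show "(\<Sum>a\<in>UNIV. ?G (det B * (a - quad B w))) = (?q - 1) / 2"
          using sum_class_indicator[OF two \<psi> False] by simp
      qed simp
      also have "\<dots> = ?q ^ n * ((?q - 1) / 2)"
        by (simp add: card_carrier_vec)
      finally have all: "(\<Sum>v\<in>carrier_vec n. \<Sum>a\<in>UNIV. ?G (det (border B v a))) = ?q ^ n * ((?q - 1) / 2)" .
      have "(\<Sum>v\<in>carrier_vec n. ?G (det (border B v 0)))
          = (\<Sum>w\<in>carrier_vec n. ?G (- det B * quad B w))"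
        by (subst reindex, intro sum.cong refl) (simp add: det_border_mult_vec[OF B])
      then have "?q * (\<Sum>v\<in>carrier_vec n. ?G (det (border B v 0)))
          = (\<Sum>c\<in>UNIV. ?G (- det B * c) * (?q ^ n + value_deviation n (det B) c))"
        using sum_quad[OF two B False, of "\<lambda>c. ?G (- det B * c)"] by simp
      also have "\<dots> = ?q ^ n * (\<Sum>c\<in>UNIV. ?G (- det B * c)) + correction \<psi> n (det B)"
        unfolding correction_def by (simp add: distrib_left sum.distrib sum_distrib_left mult.commute)
      also have "(\<Sum>c\<in>UNIV. ?G (- det B * c)) = (?q - 1) / 2"
        using sum_class_indicator[OF two \<psi>, of "- det B"] False by simp
      finally show ?thesis
        using False all by simp
    qed
  qed
  have zero: "class_count \<psi> (Suc n) (insert n K) TYPE('a)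
      = (\<Sum>B\<in>sym_mats n K. \<Sum>v\<in>carrier_vec n. ?G (det (border B v 0)))"
  proof -
    have "sym_mats (Suc n) (insert n K) = {A \<in> sym_mats (Suc n) K. A $$ (n, n) \<in> {0 :: 'a}}"
      by (auto simp: sym_mats_def)
    then show ?thesis
      using sum_sym_mats_border[OF K, where D = "{0}" and f = "\<lambda>A. ?G (det A)"] by (simp add: class_count_def)
  qed
  have all: "class_count \<psi> (Suc n) K TYPE('a)
      = (\<Sum>B\<in>sym_mats n K. \<Sum>v\<in>carrier_vec n. \<Sum>a\<in>UNIV. ?G (det (border B v a)))"
    using sum_sym_mats_border[OF K, where D = UNIV and f = "\<lambda>A. ?G (det A)"] by (simp add: class_count_def)
  show ?thesis
    unfolding zero all sum_distrib_left sum.distrib[symmetric]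
    by (rule sum.cong[OF refl]) (simp only: per_block flip: sum_distrib_left)
qed

text \<open>For a nonzero corner \<open>a\<close> the determinant is \<open>a\<close> times that of the Schur complement. For fixed
  \<open>v\<close> and \<open>a\<close> the Schur complement is a translate of \<open>B\<close>, so it may be replaced by \<open>B\<close> in the
  sum. This needs the absence of diagonal conditions, which the translation would not preserve.
  For invertible \<open>B\<close>, finally, \<open>a * det B\<close> has both characters equally often.\<close>

lemma class_count_nonzero_last:
  assumes two: "(2 :: 'a :: {field, finite}) \<noteq> 0" and \<psi>: "\<psi> \<in> {1, -1}"
  shows "class_count \<psi> (Suc n) {} TYPE('a) = class_count \<psi> (Suc n) {n} TYPE('a)
    + real (card (UNIV :: 'a set)) ^ n * ((real (card (UNIV :: 'a set)) - 1) / 2)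
      * (class_count 1 n {} TYPE('a) + class_count (-1) n {} TYPE('a))"
proof -
  let ?q = "real (card (UNIV :: 'a set))" and ?G = "class_indicator \<psi> :: 'a \<Rightarrow> real"
  let ?N = "{A \<in> sym_mats (Suc n) {}. A $$ (n, n) \<in> - {0 :: 'a}}"
  have split: "sym_mats (Suc n) {} = sym_mats (Suc n) {n} \<union> ?N" "sym_mats (Suc n) {n} \<inter> ?N = {}"
    by (auto simp: sym_mats_def)
  have "class_count \<psi> (Suc n) {} TYPE('a) = class_count \<psi> (Suc n) {n} TYPE('a) + (\<Sum>A\<in>?N. ?G (det A))"
    unfolding class_count_def
    by (subst split(1), rule sum.union_disjoint) (use split(2) in \<open>simp_all add: finite_sym_mats\<close>)
  also have "(\<Sum>A\<in>?N. ?G (det A))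
      = (\<Sum>B\<in>sym_mats n {}. \<Sum>v\<in>carrier_vec n. \<Sum>a\<in>- {0}. ?G (det (border B v a)))"
    by (rule sum_sym_mats_border) simp
  also have "\<dots> = (\<Sum>B\<in>sym_mats n {}. \<Sum>v\<in>carrier_vec n. \<Sum>a\<in>- {0}. ?G (a * det (schur B v a)))"
    by (intro sum.cong refl) (auto simp: det_border_schur sym_mats_def)
  also have "\<dots> = (\<Sum>v\<in>carrier_vec n. \<Sum>B\<in>sym_mats n {}. \<Sum>a\<in>- {0}. ?G (a * det (schur B v a)))"
    by (rule sum.swap)
  also have "\<dots> = (\<Sum>v\<in>carrier_vec n. \<Sum>a\<in>- {0}. \<Sum>B\<in>sym_mats n {}. ?G (a * det (schur B v a)))"
    by (intro sum.cong refl) (rule sum.swap)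
  also have "\<dots> = (\<Sum>v\<in>(carrier_vec n :: 'a vec set). \<Sum>a\<in>- {0}. \<Sum>B\<in>sym_mats n {}. ?G (a * det B))"
  proof (rule sum.cong[OF refl], rule sum.cong[OF refl])
    fix v :: "'a vec" and a :: 'a
    show "(\<Sum>B\<in>sym_mats n {}. ?G (a * det (schur B v a))) = (\<Sum>B\<in>sym_mats n {}. ?G (a * det B))"
    proof (rule sum.reindex_bij_witness[of _ "\<lambda>B. schur B v (- a)" "\<lambda>B. schur B v a"])
      fix B :: "'a mat" assume "B \<in> sym_mats n {}"
      then have B: "B \<in> carrier_mat n n" "transpose_mat B = B" by (auto simp: sym_mats_def)
      show "schur (schur B v a) v (- a) = B" "schur (schur B v (- a)) v a = B"
        using B(1) by (auto intro!: eq_matI simp: schur_def)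
      show "schur B v a \<in> sym_mats n {}" "schur B v (- a) \<in> sym_mats n {}"
        using transpose_schur[OF B] B(1) by (auto simp: sym_mats_def)
    qed simp
  qed
  also have "\<dots> = ?q ^ n * (\<Sum>B\<in>sym_mats n {}. \<Sum>a\<in>- {0}. ?G (a * det B))"
    by (subst sum.swap) (simp add: card_carrier_vec)
  also have "(\<Sum>B\<in>sym_mats n {}. \<Sum>a\<in>- {0}. ?G (a * det B))
      = (\<Sum>B\<in>sym_mats n {}. (?q - 1) / 2 * (class_indicator 1 (det (B :: 'a mat)) + class_indicator (-1) (det B)))"
  proof (rule sum.cong)
    fix B :: "'a mat"
    have "(\<Sum>a\<in>- {0}. ?G (a * det B)) = (\<Sum>a\<in>UNIV. ?G (det B * a))"
      by (rule sum.mono_neutral_cong_left) (auto simp: mult.commute)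
    then show "(\<Sum>a\<in>- {0}. ?G (a * det B))
        = (?q - 1) / 2 * (class_indicator 1 (det B) + class_indicator (-1) (det B))"
      using sum_class_indicator[OF two \<psi>, of "det B"] by (simp add: class_indicator_add)
  qed simp
  also have "\<dots> = (?q - 1) / 2 * (class_count 1 n {} TYPE('a) + class_count (-1) n {} TYPE('a))"
    by (simp only: class_count_def sum.distrib flip: sum_distrib_left)
  finally show ?thesis
    by simp
qed

section \<open>Placing the new zero in the corner\<close>

lemma det_permute_symmetrically:
  fixes A :: "'a :: comm_ring_1 mat"
  assumes A: "A \<in> carrier_mat n n" and p: "p permutes {0..<n}"
  shows "det (mat n n (\<lambda>(i, j). A $$ (p i, p j))) = det A"
proof -
  define R where "R = mat n n (\<lambda>(i, j). A $$ (p i, j))"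
  have p_less: "p i < n" if "i < n" for i
    using permutes_in_image[OF p, of i] that by simp
  have "mat n n (\<lambda>(i, j). A $$ (p i, p j)) = transpose_mat (mat n n (\<lambda>(i, j). transpose_mat R $$ (p i, j)))"
    by (intro eq_matI) (auto simp: R_def p_less)
  then have "det (mat n n (\<lambda>(i, j). A $$ (p i, p j))) = signof p * det R"
    using det_permute_rows[of "transpose_mat R" n p] p
    by (simp add: R_def det_transpose[of _ n])
  also have "\<dots> = signof p * signof p * det A"
    using det_permute_rows[OF A p] by (simp add: R_def)
  also have "signof p * signof p = (1 :: 'a)"
    by (simp add: sign_def)
  finally show ?thesis by simp
qed

lemma class_count_permute:
  assumes p: "p permutes {0..<n}" and K: "K \<subseteq> {..<n}"
  shows "class_count \<psi> n (p ` K) F = class_count \<psi> n K (F :: 'a :: {field, finite} itself)"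
proof -
  have p_less: "p i < n" "Hilbert_Choice.inv p i < n" if "i < n" for i
    using permutes_in_image[OF p, of i] permutes_in_image[OF permutes_inv[OF p], of i] that by simp_all
  have sym: "A $$ (j, i) = A $$ (i, j)" if "A \<in> sym_mats n L" "i < n" "j < n" for A :: "'a mat" and L i j
    using that index_transpose_mat(1)[of i A j] by (auto simp: sym_mats_def)
  show ?thesis
    unfolding class_count_def
  proof (rule sum.reindex_bij_witness[of _ "\<lambda>A. mat n n (\<lambda>(i, j). A $$ (Hilbert_Choice.inv p i, Hilbert_Choice.inv p j))"
        "\<lambda>A. mat n n (\<lambda>(i, j). A $$ (p i, p j))"])
    fix A :: "'a mat" assume A: "A \<in> sym_mats n (p ` K)"
    then have c: "A \<in> carrier_mat n n" by (simp add: sym_mats_def)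
    show "mat n n (\<lambda>(i, j). mat n n (\<lambda>(i, j). A $$ (p i, p j)) $$ (Hilbert_Choice.inv p i, Hilbert_Choice.inv p j)) = A"
      using c by (intro eq_matI) (auto simp: p_less permutes_inverses[OF p])
    show "mat n n (\<lambda>(i, j). A $$ (p i, p j)) \<in> sym_mats n K"
      using A K by (auto simp: sym_mats_def p_less sym[OF A] intro!: eq_matI)
    show "class_indicator \<psi> (det (mat n n (\<lambda>(i, j). A $$ (p i, p j)))) = class_indicator \<psi> (det A)"
      by (simp add: det_permute_symmetrically[OF c p])
  next
    fix A :: "'a mat" assume A: "A \<in> sym_mats n K"
    then have c: "A \<in> carrier_mat n n" by (simp add: sym_mats_def)
    show "mat n n (\<lambda>(i, j). mat n n (\<lambda>(i, j). A $$ (Hilbert_Choice.inv p i, Hilbert_Choice.inv p j)) $$ (p i, p j)) = A"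
      using c by (intro eq_matI) (auto simp: p_less permutes_inverses[OF p])
    have "i \<in> K \<Longrightarrow> p i < n" for i using K p_less by auto
    then show "mat n n (\<lambda>(i, j). A $$ (Hilbert_Choice.inv p i, Hilbert_Choice.inv p j)) \<in> sym_mats n (p ` K)"
      using A K by (auto simp: sym_mats_def p_less sym[OF A] permutes_inverses[OF p] intro!: eq_matI)
  qed
qed

text \<open>Exchanging the positions \<open>k\<close> and \<open>n\<close> moves the zero required at \<open>k\<close> to the corner and fixes
  the positions below \<open>k\<close>.\<close>

lemma class_count_Suc:
  assumes "k \<le> n"
  shows "class_count \<psi> (Suc n) {..<Suc k} F = class_count \<psi> (Suc n) (insert n {..<k}) F"
proof -
  let ?p = "Transposition.transpose k n"
  have "?p permutes {0..<Suc n}"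
    using assms by (intro permutes_swap_id) auto
  moreover have "?p ` insert n {..<k} = {..<Suc k}"
  proof -
    have "?p ` {..<k} = {..<k}"
      using assms by (intro transpose_image_eq) auto
    then show ?thesis by auto
  qed
  moreover have "insert n {..<k} \<subseteq> {..<Suc n}"
    using assms by auto
  ultimately show ?thesis
    using class_count_permute by metis
qed

section \<open>The recursion and the initial values\<close>

lemma class_count_recursion:
  assumes "(2 :: 'a :: {field, finite}) \<noteq> 0" and "\<psi> \<in> {1, -1}" and "k \<le> n"
  shows "real (card (UNIV :: 'a set)) * class_count \<psi> (Suc n) {..<Suc k} TYPE('a)
    = class_count \<psi> (Suc n) {..<k} TYPE('a)
      + (\<Sum>B\<in>sym_mats n {..<k}. if det (B :: 'a mat) = 0 then 0 else correction \<psi> n (det B))"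
  unfolding class_count_Suc[OF assms(3)] using assms by (intro class_count_insert_last) auto

lemma sum_correction_odd:
  assumes two: "(2 :: 'a :: {field, finite}) \<noteq> 0" and \<psi>: "\<psi> \<in> {1, -1}"
  shows "(\<Sum>B\<in>sym_mats (2 * m + 1) K. if det (B :: 'a mat) = 0 then 0 else correction \<psi> (2 * m + 1) (det B))
    = (real (card (UNIV :: 'a set)) - 1) / 2 * real (card (UNIV :: 'a set)) ^ (m + 1)
      * real_of_int \<psi> * qchar ((-1) ^ (m + 1) :: 'a)
      * (class_count 1 (2 * m + 1) K TYPE('a) + class_count (-1) (2 * m + 1) K TYPE('a))"
  unfolding class_count_def sum.distrib[symmetric] class_indicator_add sum_distrib_left
proof (rule sum.cong[OF refl])
  fix B :: "'a mat"
  let ?C = "(real (card (UNIV :: 'a set)) - 1) / 2 * real (card (UNIV :: 'a set)) ^ (m + 1)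
    * real_of_int \<psi> * qchar ((-1) ^ (m + 1) :: 'a)"
  show "(if det B = 0 then 0 else correction \<psi> (2 * m + 1) (det B)) = ?C * (if det B = 0 then 0 else 1)"
    using correction_odd[OF two \<psi> _ refl, of "det B" m]
    by (cases "det B = 0") (simp_all only: if_True if_False simp_thms mult_1_right mult_zero_right)
qed

lemma sum_correction_even:
  assumes two: "(2 :: 'a :: {field, finite}) \<noteq> 0" and \<psi>: "\<psi> \<in> {1, -1}"
  shows "(\<Sum>B\<in>sym_mats (2 * m) K. if det (B :: 'a mat) = 0 then 0 else correction \<psi> (2 * m) (det B))
    = - ((real (card (UNIV :: 'a set)) - 1) / 2 * real (card (UNIV :: 'a set)) ^ m * qchar ((-1) ^ m :: 'a)
      * (class_count 1 (2 * m) K TYPE('a) - class_count (-1) (2 * m) K TYPE('a)))"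
  unfolding class_count_def sum_subtractf[symmetric] class_indicator_diff sum_distrib_left sum_negf[symmetric]
proof (rule sum.cong[OF refl])
  fix B :: "'a mat"
  let ?C = "(real (card (UNIV :: 'a set)) - 1) / 2 * real (card (UNIV :: 'a set)) ^ m * qchar ((-1) ^ m :: 'a)"
  show "(if det B = 0 then 0 else correction \<psi> (2 * m) (det B)) = - (?C * qchar (det B))"
    using correction_even[OF two \<psi> _ refl, of "det B" m]
    by (cases "det B = 0") (simp_all only: if_True if_False simp_thms qchar_0 mult_zero_right minus_zero)
qed

lemma qchar_sign_exponent:
  fixes x :: "'a :: {field, finite}"
  assumes "x \<noteq> 0"
  shows "(-1) ^ (if is_square x then 0 else 1) = qchar x"
  using assms by (simp add: qchar_def square_sign_def)

lemma card_field_gt_1: "real (card (UNIV :: 'a :: {field, finite} set)) > 1"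
proof -
  have "card {0, 1 :: 'a} \<le> card (UNIV :: 'a set)"
    by (intro card_mono) auto
  then show ?thesis by simp
qed

text \<open>Eliminates the count with corner zero between \<open>class_count_nonzero_last\<close> and
  \<open>class_count_insert_last\<close>.\<close>

lemma class_count_all:
  assumes two: "(2 :: 'a :: {field, finite}) \<noteq> 0" and \<psi>: "\<psi> \<in> {1, -1}"
  defines "q \<equiv> real (card (UNIV :: 'a set))"
  shows "(q - 1) * class_count \<psi> (Suc n) {} TYPE('a)
    = (q - 1) / 2 * q ^ Suc n * (class_count 1 n {} TYPE('a) + class_count (-1) n {} TYPE('a))
      + (\<Sum>B\<in>sym_mats n {}. if det (B :: 'a mat) = 0 then 0 else correction \<psi> n (det B))"
proof -
  let ?X = "class_count \<psi> (Suc n) {} TYPE('a)" and ?Y = "class_count \<psi> (Suc n) {n} TYPE('a)"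
  have "(q - 1) * ?X = q * (?X - ?Y) + (q * ?Y - ?X)"
    by (simp add: algebra_simps)
  moreover have "?X - ?Y = q ^ n * ((q - 1) / 2) * (class_count 1 n {} TYPE('a) + class_count (-1) n {} TYPE('a))"
    using class_count_nonzero_last[OF two \<psi>, of n] unfolding q_def by linarith
  moreover have "q * ?Y - ?X
      = (\<Sum>B\<in>sym_mats n {}. if det (B :: 'a mat) = 0 then 0 else correction \<psi> n (det B))"
    using class_count_insert_last[OF two \<psi>, of "{}" n] unfolding q_def by simp
  ultimately show ?thesis
    by (simp only: power_Suc) simp
qed

theorem proposition4p21:
  fixes q :: nat
  assumes "q = card (UNIV :: 'a :: {field, finite} set)" and "odd q"
  shows
    "(\<forall>(n::nat) (k::nat) (\<psi>::int). n \<ge> 1 \<longrightarrow> k \<le> n \<longrightarrow> \<psi> \<in> {1, -1} \<longrightarrow>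
        (odd n \<longrightarrow>
          (let t = (if is_square ((-1 :: 'a) ^ ((n + 1) div 2)) then 0 else 1 :: nat) in
            real (sz_char TYPE('a) \<psi> (n + 1) (k + 1)) =
              1 / real q * real (sz_char TYPE('a) \<psi> (n + 1) k)
              + (-1) ^ t * real_of_int \<psi> / 2 * real (sz TYPE('a) n k)
                * (real q ^ ((n + 1) div 2) - real q ^ ((n - 1) div 2)))) \<and>
        (even n \<longrightarrow>
          (let t = (if is_square ((-1 :: 'a) ^ (n div 2)) then 0 else 1 :: nat) in
            real (sz_char TYPE('a) \<psi> (n + 1) (k + 1)) =
              1 / real q * real (sz_char TYPE('a) \<psi> (n + 1) k)
              - (-1) ^ t / 2
                * (real (sz_char TYPE('a) 1 n k) - real (sz_char TYPE('a) (-1) n k))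
                * (real q ^ (n div 2) - real q ^ ((n - 2) div 2)))))
     \<and> (\<forall>m::nat.
          real (sz_char TYPE('a) 1 (2 * m + 1) 0) = 1 / 2 * real (sz TYPE('a) (2 * m + 1) 0) \<and>
          real (sz_char TYPE('a) 1 (2 * m) 0) =
            1 / 2 * ((real q ^ m + real_of_int (square_sign (-1 :: 'a)) ^ m) / real q ^ m)
              * real (sz TYPE('a) (2 * m) 0))"
proof -
  have two: "(2 :: 'a) \<noteq> 0"
    using two_neq_0 assms by blast
  have q: "real (card (UNIV :: 'a set)) = real q" and q1: "real q > 1"
    using card_field_gt_1[where ?'a = 'a] assms(1) by simp_all
  have odd_case: "real (sz_char TYPE('a) \<psi> (n + 1) (k + 1)) =
      1 / real q * real (sz_char TYPE('a) \<psi> (n + 1) k)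
      + qchar ((-1 :: 'a) ^ ((n + 1) div 2)) * real_of_int \<psi> / 2 * real (sz TYPE('a) n k)
        * (real q ^ ((n + 1) div 2) - real q ^ ((n - 1) div 2))"
    if "k \<le> n" "\<psi> \<in> {1, -1}" "odd n" for n k \<psi>
  proof -
    obtain m where n: "n = 2 * m + 1" using \<open>odd n\<close> by (rule oddE)
    then have div: "(n + 1) div 2 = m + 1" "(n - 1) div 2 = m" by simp_all
    have "real q * class_count \<psi> (Suc n) {..<Suc k} TYPE('a) = class_count \<psi> (Suc n) {..<k} TYPE('a)
        + (real q - 1) / 2 * real q ^ (m + 1) * real_of_int \<psi> * qchar ((-1) ^ (m + 1) :: 'a)
          * real (sz TYPE('a) n k)"
      using class_count_recursion[OF two that(2,1)] sum_correction_odd[OF two that(2), of m "{..<k}"]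
      unfolding q n sz_eq by simp
    then show ?thesis
      unfolding div using q1 by (simp add: sz_char_eq field_simps)
  qed
  have even_case: "real (sz_char TYPE('a) \<psi> (n + 1) (k + 1)) =
      1 / real q * real (sz_char TYPE('a) \<psi> (n + 1) k)
      - qchar ((-1 :: 'a) ^ (n div 2)) / 2
        * (real (sz_char TYPE('a) 1 n k) - real (sz_char TYPE('a) (-1) n k))
        * (real q ^ (n div 2) - real q ^ ((n - 2) div 2))"
    if "n \<ge> 1" "k \<le> n" "\<psi> \<in> {1, -1}" "even n" for n k \<psi>
  proof -
    obtain j where "n = 2 * j" using \<open>even n\<close> by (rule evenE)
    then obtain m where n: "n = 2 * Suc m"
      using \<open>n \<ge> 1\<close> by (cases j) auto
    then have div: "n div 2 = Suc m" "(n - 2) div 2 = m" by simp_all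
    have "real q * class_count \<psi> (Suc n) {..<Suc k} TYPE('a) = class_count \<psi> (Suc n) {..<k} TYPE('a)
        - (real q - 1) / 2 * real q ^ Suc m * qchar ((-1) ^ Suc m :: 'a)
          * (class_count 1 n {..<k} TYPE('a) - class_count (-1) n {..<k} TYPE('a))"
      using class_count_recursion[OF two that(3,2)] sum_correction_even[OF two that(3), of "Suc m" "{..<k}"]
      unfolding q n by simp
    then show ?thesis
      unfolding div using q1 by (simp add: sz_char_eq field_simps)
  qed
  have init_odd: "real (sz_char TYPE('a) 1 (2 * m + 1) 0) = 1 / 2 * real (sz TYPE('a) (2 * m + 1) 0)" for m
  proof -
    have "(real q - 1) * class_count 1 (Suc (2 * m)) {} TYPE('a)
        = (real q - 1) * class_count (-1) (Suc (2 * m)) {} TYPE('a)"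
      using class_count_all[OF two, of 1 "2 * m"] class_count_all[OF two, of "-1" "2 * m"]
        sum_correction_even[OF two, of 1 m "{}"] sum_correction_even[OF two, of "-1" m "{}"]
      by (simp add: q)
    then show ?thesis
      using q1 by (simp add: sz_eq sz_char_eq)
  qed
  have init_even: "real (sz_char TYPE('a) 1 (2 * m) 0) =
      1 / 2 * ((real q ^ m + real_of_int (square_sign (-1 :: 'a)) ^ m) / real q ^ m)
        * real (sz TYPE('a) (2 * m) 0)" for m
  proof (cases m)
    case 0
    \<comment> \<open>Size zero has no smaller size to refer to; the empty matrix has determinant \<open>1\<close>, a square.\<close>
    have one: "sym_mats 0 {} = {1\<^sub>m 0 :: 'a mat}"
      by (auto simp: sym_mats_def intro!: eq_matI)
    have "class_count 1 0 {} TYPE('a) = 1" "class_count (-1) 0 {} TYPE('a) = 0"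
      by (simp_all add: class_count_def one class_indicator_def square_sign_def)
    then show ?thesis
      using 0 by (simp add: sz_eq sz_char_eq)
  next
    case (Suc l)
    define S where "S = class_count 1 (2 * l + 1) {} TYPE('a) + class_count (-1) (2 * l + 1) {} TYPE('a)"
    define e where "e = qchar ((-1) ^ m :: 'a)"
    have count: "class_count \<psi> (2 * m) {} TYPE('a) = (real q ^ (2 * m) + real q ^ m * real_of_int \<psi> * e) / 2 * S"
      if "\<psi> \<in> {1, -1}" for \<psi>
    proof -
      have "Suc (2 * l + 1) = 2 * m" "l + 1 = m" using Suc by simp_all
      then have "(real q - 1) * class_count \<psi> (2 * m) {} TYPE('a)
          = (real q - 1) / 2 * real q ^ (2 * m) * S + (real q - 1) / 2 * real q ^ m * real_of_int \<psi> * e * S"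
        using class_count_all[OF two that, of "2 * l + 1"] sum_correction_odd[OF two that, of l "{}"]
        by (simp only: q S_def e_def)
      also have "\<dots> = (real q - 1) * ((real q ^ (2 * m) + real q ^ m * real_of_int \<psi> * e) / 2 * S)"
        by (simp add: field_simps)
      finally have "(real q - 1) * class_count \<psi> (2 * m) {} TYPE('a)
          = (real q - 1) * ((real q ^ (2 * m) + real q ^ m * real_of_int \<psi> * e) / 2 * S)" .
      then show ?thesis
        using q1 by simp
    qed
    have "qchar ((-1) ^ j :: 'a) = qchar (-1 :: 'a) ^ j" for j
      by (induction j) (simp_all only: power_Suc power_0 qchar_mult[OF two] qchar_1)
    then have e: "e = real_of_int (square_sign (-1 :: 'a)) ^ m"
      by (simp add: e_def qchar_def)
    have "real (sz TYPE('a) (2 * m) 0) = real q ^ (2 * m) * S"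
      using count[of 1] count[of "-1"] by (simp add: sz_eq algebra_simps)
    moreover have "real (sz_char TYPE('a) 1 (2 * m) 0) = (real q ^ (2 * m) + real q ^ m * e) / 2 * S"
      using count[of 1] by (simp add: sz_char_eq)
    moreover have "real q ^ (2 * m) = real q ^ m * real q ^ m"
      by (simp add: mult_2 power_add)
    moreover have "real q ^ m \<noteq> 0"
      using q1 by simp
    moreover have "(Q * Q + Q * e) / 2 * S = 1 / 2 * ((Q + e) / Q) * (Q * Q * S)" if "Q \<noteq> 0" for Q :: real
      using that by (simp add: field_simps)
    ultimately show ?thesis
      by (simp only: e[symmetric])
  qed
  have exponent: "(-1) ^ (if is_square ((-1 :: 'a) ^ j) then 0 else 1) = qchar ((-1 :: 'a) ^ j)" for j
    by (rule qchar_sign_exponent) simp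
  show ?thesis
    unfolding Let_def exponent
    by (intro conjI allI impI; (rule odd_case even_case init_odd init_even; assumption)?)
qed

end
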